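(* For every $p$-local finite group $(S,\mathcal{F},\mathcal{L})$, the functor $\widetilde\pi:\mathcal{L}\to\mathcal{O}^c(\mathcal{F})$ defines a target regular extension $$\{P\}_{P\in\mathcal{F}^c}\xrightarrow{j}\mathcal{L}\xrightarrow{\widetilde\pi}\mathcal{O}^c(\mathcal{F}),$$ where for every $P\in\mathcal{F}^c$ the homomorphism $j_P:P\to\mathrm{Aut}_{\mathcal{L}}(P)$ is the restriction of $\epsilon_{P,P}:N_S(P)\to\mathrm{Aut}_{\mathcal{L}}(P)$ to the subgroup $P$. (That is, $\widetilde\pi$ is target regular, and $j_P$ identifies $P$ with $\ker\{\mathrm{Aut}_{\mathcal{L}}(P)\to\mathrm{Aut}_{\mathcal{O}^c(\mathcal{F})}(P)\}$ for every $P\in\mathcal{F}^c$.)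
   Context: Target regular functor: a functor $\pi:\mathcal{C}\to\mathcal{D}$ between small categories with $\mathrm{Ob}(\mathcal{C})=\mathrm{Ob}(\mathcal{D})$, identity on objects, such that with $K(x)=\ker\{\mathrm{Aut}_{\mathcal{C}}(x)\to\mathrm{Aut}_{\mathcal{D}}(x)\}$, for all $x,y$ the group $K(y)$ acts freely by postcomposition on $\mathcal{C}(x,y)$ and $\pi_{x,y}$ induces a bijection $K(y)\backslash\mathcal{C}(x,y)\cong\mathcal{D}(x,y)$. The target regular extension $\{K(x)\}\to\mathcal{C}\to\mathcal{D}$ is $\pi$ together with the kernel groups and their inclusions into the automorphism groups. Fusion systems. A fusion system $\mathcal{F}$ over a finite $p$-group $S$ is a category whose objects are the subgroups of $S$, whose morphism sets satisfy $\mathrm{Hom}_S(P,Q)\subseteq\mathrm{Mor}_{\mathcal{F}}(P,Q)\subseteq\mathrm{Inj}(P,Q)$ ($\mathrm{Hom}_S$ = conjugations by elements of $S$), and such that every $\varphi\in\mathrm{Mor}_{\mathcal{F}}(P,Q)$ is an $\mathcal{F}$-isomorphism $P\to\varphi(P)$ followed by an inclusion. All fusion systems are assumed saturated: each $\mathcal{F}$-isomorphism class contains a subgroup $P$ such that $\mathrm{Aut}_S(P)$ is a Sylow $p$-subgroup of $\mathrm{Aut}_{\mathcal{F}}(P)$ and every $\mathcal{F}$-isomorphism $\varphi:Q\to P$ extends to a morphism in $\mathcal{F}$ from $N_\varphi=\{g\in N_S(Q):\varphi c_g\varphi^{-1}\in\mathrm{Aut}_S(P)\}$ to $S$. A subgroup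 $P\le S$ is $\mathcal{F}$-centric if $C_S(Q)\le Q$ for all $Q$ that are $\mathcal{F}$-isomorphic to $P$; $\mathcal{F}^c$ is the full subcategory of $\mathcal{F}$ on the $\mathcal{F}$-centric subgroups. Centric linking systems. Let $\mathcal{T}^c_S(S)$ be the category whose objects are the $\mathcal{F}$-centric subgroups, with morphism sets $N_S(P,Q)=\{g\in S: gPg^{-1}\le Q\}$ and composition given by multiplication. A centric linking system associated to $\mathcal{F}$ is a category $\mathcal{L}$ whose objects are the $\mathcal{F}$-centric subgroups with functors $\mathcal{T}^c_S(S)\xrightarrow{\epsilon}\mathcal{L}\xrightarrow{\pi}\mathcal{F}^c$ such that: (1) $\epsilon,\pi$ are the identity on objects, $\epsilon$ is injective and $\pi$ is surjective on morphism sets; (2) $\epsilon_{P,P}(P)$ acts freely on $\mathrm{Mor}_{\mathcal{L}}(P,Q)$ by precomposition and $\pi_{P,Q}$ induces a bijection $\mathrm{Mor}_{\mathcal{L}}(P,Q)/\epsilon_{P,P}(Z(P))\cong\mathrm{Mor}_{\mathcal{F}^c}(P,Q)$; (3) $\pi(\epsilon(g))=c_g$ for $g\in N_S(P,Q)$; (4) for $\psi\in\mathrm{Mor}_{\mathcal{L}}(P,Q)$ and $g\in P$, $\psi\circ\epsilon_{P,P}(g)=\epsilon_{Q,Q}(\pi(\psi)(g))\circ\psi$. A $p$-local finite group is a triple $(S,\mathcal{F},\mathcal{L})$ with $\mathcal{F}$ a saturated fusion system over $S$ and $\mathcal{L}$ an associated centric linking system. The orbit category $\mathcal{O}^c(\mathcal{F})$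 has as objects the $\mathcal{F}$-centric subgroups and morphisms $\mathrm{Inn}(Q)\backslash\mathrm{Mor}_{\mathcal{F}}(P,Q)$; $\widetilde\pi$ is the composite of $\pi:\mathcal{L}\to\mathcal{F}^c$ with the quotient functor $\mathcal{F}^c\to\mathcal{O}^c(\mathcal{F})$. *)

theory Defs
  imports "HOL-Algebra.Group_Action" "HOL-Algebra.Sylow"
begin

section \<open>Categories\<close>

text \<open>
  Morphism sets are not required to be disjoint, so composition and the action of a functor on
  morphisms carry the objects as explicit arguments: \<open>Comp C x y z g f\<close> is the composite of
  \<open>f : x \<rightarrow> y\<close> followed by \<open>g : y \<rightarrow> z\<close>.
\<close>

record ('o, 'm) category =
  Ob :: "'o set"
  Hom :: "'o \<Rightarrow> 'o \<Rightarrow> 'm set"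
  Id :: "'o \<Rightarrow> 'm"
  Comp :: "'o \<Rightarrow> 'o \<Rightarrow> 'o \<Rightarrow> 'm \<Rightarrow> 'm \<Rightarrow> 'm"

definition is_category :: "('o, 'm) category \<Rightarrow> bool" where
  "is_category C \<longleftrightarrow>
     (\<forall>x\<in>Ob C. Id C x \<in> Hom C x x) \<and>
     (\<forall>x\<in>Ob C. \<forall>y\<in>Ob C. \<forall>z\<in>Ob C. \<forall>f\<in>Hom C x y. \<forall>g\<in>Hom C y z.
        Comp C x y z g f \<in> Hom C x z) \<and>
     (\<forall>x\<in>Ob C. \<forall>y\<in>Ob C. \<forall>f\<in>Hom C x y.
        Comp C x y y (Id C y) f = f \<and> Comp C x x y f (Id C x) = f) \<and>
     (\<forall>w\<in>Ob C. \<forall>x\<in>Ob C. \<forall>y\<in>Ob C. \<forall>z\<in>Ob C.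
        \<forall>f\<in>Hom C w x. \<forall>g\<in>Hom C x y. \<forall>h\<in>Hom C y z.
        Comp C w y z h (Comp C w x y g f) = Comp C w x z (Comp C x y z h g) f)"

definition cat_isos :: "('o, 'm) category \<Rightarrow> 'o \<Rightarrow> 'o \<Rightarrow> 'm set" where
  "cat_isos C x y =
     {f \<in> Hom C x y. \<exists>g\<in>Hom C y x. Comp C x y x g f = Id C x \<and> Comp C y x y f g = Id C y}"

definition aut_group :: "('o, 'm) category \<Rightarrow> 'o \<Rightarrow> 'm monoid" where
  "aut_group C x = \<lparr>carrier = cat_isos C x x, monoid.mult = Comp C x x x, monoid.one = Id C x\<rparr>"

definition full_subcategory :: "('o, 'm) category \<Rightarrow> 'o set \<Rightarrow> ('o, 'm) category" where
  "full_subcategory C X = C\<lparr>Ob := X\<rparr>"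

definition id_on_objects_functor ::
    "('o, 'm) category \<Rightarrow> ('o, 'n) category \<Rightarrow> ('o \<Rightarrow> 'o \<Rightarrow> 'm \<Rightarrow> 'n) \<Rightarrow> bool" where
  "id_on_objects_functor C D \<Phi> \<longleftrightarrow>
     is_category C \<and> is_category D \<and> Ob C = Ob D \<and>
     (\<forall>x\<in>Ob C. \<forall>y\<in>Ob C. \<forall>f\<in>Hom C x y. \<Phi> x y f \<in> Hom D x y) \<and>
     (\<forall>x\<in>Ob C. \<Phi> x x (Id C x) = Id D x) \<and>
     (\<forall>x\<in>Ob C. \<forall>y\<in>Ob C. \<forall>z\<in>Ob C. \<forall>f\<in>Hom C x y. \<forall>g\<in>Hom C y z.
        \<Phi> x z (Comp C x y z g f) = Comp D x y z (\<Phi> y z g) (\<Phi> x y f))"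


section \<open>Target regular extensions\<close>

text \<open>
  The next two notions are used for actions by pre- and postcomposition in a category; that these
  are actions is then automatic, and only freeness and the orbits matter.  Both are insensitive to
  whether the action is a left or a right one.
\<close>

definition acts_freely ::
    "('g, 'r) monoid_scheme \<Rightarrow> 'x set \<Rightarrow> ('g \<Rightarrow> 'x \<Rightarrow> 'x) \<Rightarrow> bool" where
  "acts_freely G X \<phi> \<longleftrightarrow> (\<forall>x\<in>X. stabilizer G \<phi> x = {\<one>\<^bsub>G\<^esub>})"

definition induces_bij_on_orbits ::
    "('g, 'r) monoid_scheme \<Rightarrow> 'x set \<Rightarrow> ('g \<Rightarrow> 'x \<Rightarrow> 'x) \<Rightarrow> ('x \<Rightarrow> 'y) \<Rightarrow> 'y set \<Rightarrow> bool" where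
  "induces_bij_on_orbits G X \<phi> f Y \<longleftrightarrow>
     (\<forall>A\<in>orbits G X \<phi>. \<forall>a\<in>A. \<forall>b\<in>A. f a = f b) \<and>
     bij_betw (\<lambda>A. the_elem (f ` A)) (orbits G X \<phi>) Y"

definition kernel_group ::
    "('o, 'm) category \<Rightarrow> ('o, 'n) category \<Rightarrow> ('o \<Rightarrow> 'o \<Rightarrow> 'm \<Rightarrow> 'n) \<Rightarrow> 'o \<Rightarrow> 'm monoid" where
  "kernel_group C D \<Phi> x =
     (aut_group C x)\<lparr>carrier := kernel (aut_group C x) (aut_group D x) (\<Phi> x x)\<rparr>"

definition target_regular ::
    "('o, 'm) category \<Rightarrow> ('o, 'n) category \<Rightarrow> ('o \<Rightarrow> 'o \<Rightarrow> 'm \<Rightarrow> 'n) \<Rightarrow> bool" where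
  "target_regular C D \<Phi> \<longleftrightarrow>
     id_on_objects_functor C D \<Phi> \<and>
     (\<forall>x\<in>Ob C. \<forall>y\<in>Ob C.
        acts_freely (kernel_group C D \<Phi> y) (Hom C x y) (\<lambda>k f. Comp C x y y k f) \<and>
        induces_bij_on_orbits (kernel_group C D \<Phi> y) (Hom C x y) (\<lambda>k f. Comp C x y y k f)
          (\<Phi> x y) (Hom D x y))"

text \<open>
  The groups \<open>K x\<close> need not literally be the kernels; \<open>j x\<close> identifies \<open>K x\<close> with the kernel.
\<close>

definition target_regular_extension ::
    "('o \<Rightarrow> ('k, 'r) monoid_scheme) \<Rightarrow> ('o \<Rightarrow> 'k \<Rightarrow> 'm) \<Rightarrow> ('o, 'm) category \<Rightarrow>
     ('o \<Rightarrow> 'o \<Rightarrow> 'm \<Rightarrow> 'n) \<Rightarrow> ('o, 'n) category \<Rightarrow> bool" where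
  "target_regular_extension K j C \<Phi> D \<longleftrightarrow>
     target_regular C D \<Phi> \<and> (\<forall>x\<in>Ob C. j x \<in> iso (K x) (kernel_group C D \<Phi> x))"


section \<open>Fusion systems\<close>

definition transporter :: "('a, 'b) monoid_scheme \<Rightarrow> 'a set \<Rightarrow> 'a set \<Rightarrow> 'a set" where
  "transporter S P Q = {g \<in> carrier S. g <#\<^bsub>S\<^esub> P #>\<^bsub>S\<^esub> inv\<^bsub>S\<^esub> g \<subseteq> Q}"

definition conj_map :: "('a, 'b) monoid_scheme \<Rightarrow> 'a set \<Rightarrow> 'a \<Rightarrow> 'a \<Rightarrow> 'a" where
  "conj_map S P g = (\<lambda>x\<in>P. g \<otimes>\<^bsub>S\<^esub> x \<otimes>\<^bsub>S\<^esub> inv\<^bsub>S\<^esub> g)"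

definition Hom_conj :: "('a, 'b) monoid_scheme \<Rightarrow> 'a set \<Rightarrow> 'a set \<Rightarrow> ('a \<Rightarrow> 'a) set" where
  "Hom_conj S P Q = conj_map S P ` transporter S P Q"

definition Inj_hom :: "('a, 'b) monoid_scheme \<Rightarrow> 'a set \<Rightarrow> 'a set \<Rightarrow> ('a \<Rightarrow> 'a) set" where
  "Inj_hom S P Q =
     {\<phi> \<in> hom (S\<lparr>carrier := P\<rparr>) (S\<lparr>carrier := Q\<rparr>). \<phi> \<in> extensional P \<and> inj_on \<phi> P}"

definition centralizer :: "('a, 'b) monoid_scheme \<Rightarrow> 'a set \<Rightarrow> 'a set" where
  "centralizer S Q = {g \<in> carrier S. \<forall>x\<in>Q. g \<otimes>\<^bsub>S\<^esub> x = x \<otimes>\<^bsub>S\<^esub> g}"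

definition center :: "('a, 'b) monoid_scheme \<Rightarrow> 'a set" where
  "center S = centralizer S (carrier S)"

definition finite_p_group :: "nat \<Rightarrow> ('a, 'b) monoid_scheme \<Rightarrow> bool" where
  "finite_p_group p S \<longleftrightarrow> prime p \<and> group S \<and> finite (carrier S) \<and> (\<exists>n. order S = p ^ n)"

definition sylow_subgroup :: "nat \<Rightarrow> ('a, 'b) monoid_scheme \<Rightarrow> 'a set \<Rightarrow> bool" where
  "sylow_subgroup p G H \<longleftrightarrow> subgroup H G \<and> card H = p ^ multiplicity p (order G)"

text \<open>
  A fusion system over \<open>S\<close> is given by its morphism sets \<open>F P Q\<close> (functions are extensional,
  i.e. \<open>undefined\<close> outside their domain); the values of \<open>F\<close> at sets that are not subgroups
  are irrelevant.
\<close>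

type_synonym 'a fusion = "'a set \<Rightarrow> 'a set \<Rightarrow> ('a \<Rightarrow> 'a) set"

definition fusion_category ::
    "('a, 'b) monoid_scheme \<Rightarrow> 'a fusion \<Rightarrow> ('a set, 'a \<Rightarrow> 'a) category" where
  "fusion_category S F =
     \<lparr>Ob = {P. subgroup P S}, Hom = F, Id = (\<lambda>P. \<lambda>x\<in>P. x),
      Comp = (\<lambda>P Q R g f. compose P g f)\<rparr>"

definition fusion_system :: "('a, 'b) monoid_scheme \<Rightarrow> 'a fusion \<Rightarrow> bool" where
  "fusion_system S F \<longleftrightarrow>
     is_category (fusion_category S F) \<and>
     (\<forall>P Q. subgroup P S \<longrightarrow> subgroup Q S \<longrightarrow>
        Hom_conj S P Q \<subseteq> F P Q \<and> F P Q \<subseteq> Inj_hom S P Q \<and>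
        (\<forall>\<phi>\<in>F P Q. \<phi> \<in> cat_isos (fusion_category S F) P (\<phi> ` P)))"

definition F_conjugates :: "('a, 'b) monoid_scheme \<Rightarrow> 'a fusion \<Rightarrow> 'a set \<Rightarrow> 'a set set" where
  "F_conjugates S F P = {Q. subgroup Q S \<and> cat_isos (fusion_category S F) P Q \<noteq> {}}"

definition extension_normalizer ::
    "('a, 'b) monoid_scheme \<Rightarrow> 'a set \<Rightarrow> 'a set \<Rightarrow> ('a \<Rightarrow> 'a) \<Rightarrow> 'a set" where
  "extension_normalizer S Q P \<phi> =
     {g \<in> normalizer S Q. compose P \<phi> (compose P (conj_map S Q g) (inv_into Q \<phi>)) \<in> Hom_conj S P P}"

definition saturated :: "nat \<Rightarrow> ('a, 'b) monoid_scheme \<Rightarrow> 'a fusion \<Rightarrow> bool" where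
  "saturated p S F \<longleftrightarrow>
     (\<forall>R. subgroup R S \<longrightarrow> (\<exists>P\<in>F_conjugates S F R.
        sylow_subgroup p (aut_group (fusion_category S F) P) (Hom_conj S P P) \<and>
        (\<forall>Q \<phi>. subgroup Q S \<longrightarrow> \<phi> \<in> cat_isos (fusion_category S F) Q P \<longrightarrow>
           (\<exists>\<psi>\<in>F (extension_normalizer S Q P \<phi>) (carrier S). \<forall>x\<in>Q. \<psi> x = \<phi> x))))"

definition saturated_fusion_system ::
    "nat \<Rightarrow> ('a, 'b) monoid_scheme \<Rightarrow> 'a fusion \<Rightarrow> bool" where
  "saturated_fusion_system p S F \<longleftrightarrow>
     finite_p_group p S \<and> fusion_system S F \<and> saturated p S F"

definition centric :: "('a, 'b) monoid_scheme \<Rightarrow> 'a fusion \<Rightarrow> 'a set \<Rightarrow> bool" where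
  "centric S F P \<longleftrightarrow> subgroup P S \<and> (\<forall>Q\<in>F_conjugates S F P. centralizer S Q \<subseteq> Q)"

definition centric_category ::
    "('a, 'b) monoid_scheme \<Rightarrow> 'a fusion \<Rightarrow> ('a set, 'a \<Rightarrow> 'a) category" where
  "centric_category S F = full_subcategory (fusion_category S F) {P. centric S F P}"


section \<open>Centric linking systems\<close>

definition transporter_category ::
    "('a, 'b) monoid_scheme \<Rightarrow> 'a fusion \<Rightarrow> ('a set, 'a) category" where
  "transporter_category S F =
     \<lparr>Ob = {P. centric S F P}, Hom = transporter S, Id = (\<lambda>P. \<one>\<^bsub>S\<^esub>),
      Comp = (\<lambda>P Q R g h. g \<otimes>\<^bsub>S\<^esub> h)\<rparr>"

definition centric_linking_system ::
    "('a, 'b) monoid_scheme \<Rightarrow> 'a fusion \<Rightarrow> ('a set, 'm) category \<Rightarrow>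
     ('a set \<Rightarrow> 'a set \<Rightarrow> 'a \<Rightarrow> 'm) \<Rightarrow> ('a set \<Rightarrow> 'a set \<Rightarrow> 'm \<Rightarrow> 'a \<Rightarrow> 'a) \<Rightarrow> bool" where
  "centric_linking_system S F L \<epsilon> \<pi> \<longleftrightarrow>
     id_on_objects_functor (transporter_category S F) L \<epsilon> \<and>
     id_on_objects_functor L (centric_category S F) \<pi> \<and>
     (\<forall>P\<in>Ob L. \<forall>Q\<in>Ob L.
        inj_on (\<epsilon> P Q) (transporter S P Q) \<and>
        \<pi> P Q ` Hom L P Q = F P Q \<and>
        acts_freely ((aut_group L P)\<lparr>carrier := \<epsilon> P P ` P\<rparr>) (Hom L P Q)
          (\<lambda>a \<psi>. Comp L P P Q \<psi> a) \<and>
        induces_bij_on_orbits ((aut_group L P)\<lparr>carrier := \<epsilon> P P ` center (S\<lparr>carrier := P\<rparr>)\<rparr>)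
          (Hom L P Q) (\<lambda>a \<psi>. Comp L P P Q \<psi> a) (\<pi> P Q) (F P Q) \<and>
        (\<forall>g\<in>transporter S P Q. \<pi> P Q (\<epsilon> P Q g) = conj_map S P g) \<and>
        (\<forall>\<psi>\<in>Hom L P Q. \<forall>g\<in>P.
           Comp L P P Q \<psi> (\<epsilon> P P g) = Comp L P Q Q (\<epsilon> Q Q (\<pi> P Q \<psi> g)) \<psi>))"

definition p_local_finite_group ::
    "nat \<Rightarrow> ('a, 'b) monoid_scheme \<Rightarrow> 'a fusion \<Rightarrow> ('a set, 'm) category \<Rightarrow>
     ('a set \<Rightarrow> 'a set \<Rightarrow> 'a \<Rightarrow> 'm) \<Rightarrow> ('a set \<Rightarrow> 'a set \<Rightarrow> 'm \<Rightarrow> 'a \<Rightarrow> 'a) \<Rightarrow> bool" where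
  "p_local_finite_group p S F L \<epsilon> \<pi> \<longleftrightarrow>
     saturated_fusion_system p S F \<and> centric_linking_system S F L \<epsilon> \<pi>"


section \<open>The orbit category\<close>

definition Inn_group :: "('a, 'b) monoid_scheme \<Rightarrow> 'a set \<Rightarrow> ('a \<Rightarrow> 'a) monoid" where
  "Inn_group S Q = \<lparr>carrier = conj_map S Q ` Q, monoid.mult = compose Q, monoid.one = (\<lambda>x\<in>Q. x)\<rparr>"

definition Inn_class ::
    "('a, 'b) monoid_scheme \<Rightarrow> 'a set \<Rightarrow> 'a set \<Rightarrow> ('a \<Rightarrow> 'a) \<Rightarrow> ('a \<Rightarrow> 'a) set" where
  "Inn_class S P Q \<phi> = orbit (Inn_group S Q) (\<lambda>c \<phi>. compose P c \<phi>) \<phi>"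

text \<open>
  Composition is elementwise.  Since \<open>\<psi> \<circ> c_q = c_r \<circ> \<psi>\<close> with \<open>r = \<psi> q\<close>, the product of the
  classes of \<open>\<psi>\<close> and \<open>\<phi>\<close> is the class of \<open>\<psi> \<circ> \<phi>\<close>.
\<close>

definition orbit_category ::
    "('a, 'b) monoid_scheme \<Rightarrow> 'a fusion \<Rightarrow> ('a set, ('a \<Rightarrow> 'a) set) category" where
  "orbit_category S F =
     \<lparr>Ob = {P. centric S F P},
      Hom = (\<lambda>P Q. orbits (Inn_group S Q) (F P Q) (\<lambda>c \<phi>. compose P c \<phi>)),
      Id = (\<lambda>P. Inn_class S P P (\<lambda>x\<in>P. x)),
      Comp = (\<lambda>P Q R B A. {compose P \<psi> \<phi> | \<psi> \<phi>. \<psi> \<in> B \<and> \<phi> \<in> A})\<rparr>"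

definition orbit_projection ::
    "('a, 'b) monoid_scheme \<Rightarrow> ('a set \<Rightarrow> 'a set \<Rightarrow> 'm \<Rightarrow> 'a \<Rightarrow> 'a) \<Rightarrow>
     'a set \<Rightarrow> 'a set \<Rightarrow> 'm \<Rightarrow> ('a \<Rightarrow> 'a) set" where
  "orbit_projection S \<pi> P Q \<psi> = Inn_class S P Q (\<pi> P Q \<psi>)"

end

theory Submission
  imports Defs
begin

text \<open>
  An automorphism \<open>f\<close> of \<open>P\<close> in \<open>\<L>\<close> is killed in the orbit category iff \<open>\<pi> f = c\<^sub>g = \<pi> (\<epsilon> g)\<close> for
  some \<open>g \<in> P\<close>, that is, iff \<open>f = \<epsilon> g \<circ> \<epsilon> z = \<epsilon> (g z)\<close> with \<open>z \<in> Z(P)\<close>; so the kernel is \<open>\<epsilon> P\<close>.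
  If \<open>\<epsilon> q \<circ> \<psi> = \<psi>\<close> with \<open>q \<in> Q\<close> and \<open>\<psi> : P \<rightarrow> Q\<close>, then \<open>q\<close> centralizes \<open>\<pi> \<psi> (P)\<close>, so \<open>q = \<pi> \<psi> x\<close> for
  some \<open>x \<in> P\<close> because \<open>P\<close> is centric; then \<open>\<psi> \<circ> \<epsilon> x = \<epsilon> q \<circ> \<psi> = \<psi>\<close>, and \<open>x = 1\<close> since
  precomposition is free.  If \<open>\<pi> \<psi>' = c\<^sub>q \<circ> \<pi> \<psi>\<close>, then
  \<open>\<psi>' = \<epsilon> q \<circ> \<psi> \<circ> \<epsilon> z = \<epsilon> (q \<cdot> \<pi> \<psi> z) \<circ> \<psi>\<close> for some \<open>z \<in> Z(P)\<close>, so \<open>\<psi>\<close> and \<open>\<psi>'\<close> are in the same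
  \<open>Q\<close>-orbit.
\<close>

section \<open>Orbit maps and categories\<close>

text \<open>Equal values give equal orbits by injectivity on the set of orbits. Since
  \<open>G\<close> is an arbitrary record here, that a point lies in its own orbit has to be
  assumed.\<close>

lemma induces_bij_on_orbitsD:
  assumes "induces_bij_on_orbits G X \<phi> f Y" "a \<in> X" "b \<in> X" "f a = f b"
    and "a \<in> orbit G \<phi> a" "b \<in> orbit G \<phi> b"
  shows "b \<in> orbit G \<phi> a"
proof -
  \<comment> \<open>Being constant on the orbit, \<open>f\<close> has a singleton image there;
    \<open>c\<close> lying in its own orbit tells which singleton.\<close>
  have *: "the_elem (f ` orbit G \<phi> c) = f c" if "c \<in> X" "c \<in> orbit G \<phi> c" for c
  proof -
    have "orbit G \<phi> c \<in> orbits G X \<phi>" using that by (auto simp: orbits_def)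
    then have "f ` orbit G \<phi> c = {f c}"
      using assms(1) that unfolding induces_bij_on_orbits_def by blast
    then show ?thesis by simp
  qed
  have "orbit G \<phi> a \<in> orbits G X \<phi>" "orbit G \<phi> b \<in> orbits G X \<phi>"
    using assms by (auto simp: orbits_def)
  then have "orbit G \<phi> a = orbit G \<phi> b"
    using assms * unfolding induces_bij_on_orbits_def bij_betw_def inj_on_def by metis
  then show ?thesis using assms by simp
qed

text \<open>Reduces the condition on orbits to statements about points: \<open>f\<close> is constant
  on each orbit and takes its value at the base point, so the map on orbits is computed by
  representatives.\<close>

lemma induces_bij_on_orbitsI:
  assumes inv: "\<And>g x. g \<in> carrier G \<Longrightarrow> x \<in> X \<Longrightarrow> f (\<phi> g x) = f x"
    and self: "\<And>x. x \<in> X \<Longrightarrow> x \<in> orbit G \<phi> x"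
    and inj: "\<And>x y. x \<in> X \<Longrightarrow> y \<in> X \<Longrightarrow> f x = f y \<Longrightarrow> orbit G \<phi> x = orbit G \<phi> y"
    and surj: "f ` X = Y"
  shows "induces_bij_on_orbits G X \<phi> f Y"
proof -
  have im: "f ` orbit G \<phi> x = {f x}" if "x \<in> X" for x
    using that self[of x] inv by (auto simp: orbit_def)
  have te: "the_elem (f ` orbit G \<phi> x) = f x" if "x \<in> X" for x
    using im[OF that] by simp
  have "bij_betw (\<lambda>A. the_elem (f ` A)) (orbits G X \<phi>) Y"
  proof (rule bij_betw_imageI)
    show "inj_on (\<lambda>A. the_elem (f ` A)) (orbits G X \<phi>)"
    proof (rule inj_onI)
      fix A B assume "A \<in> orbits G X \<phi>" "B \<in> orbits G X \<phi>"
        and eq: "the_elem (f ` A) = the_elem (f ` B)"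
      then obtain x y where xy: "x \<in> X" "A = orbit G \<phi> x" "y \<in> X" "B = orbit G \<phi> y"
        unfolding orbits_def by blast
      then have "f x = f y" using eq te by simp
      then show "A = B" using inj[of x y] xy by simp
    qed
    have "(\<lambda>A. the_elem (f ` A)) ` orbits G X \<phi> = f ` X"
      using te by (force simp: orbits_def image_iff)
    then show "(\<lambda>A. the_elem (f ` A)) ` orbits G X \<phi> = Y" using surj by simp
  qed
  moreover have "\<forall>A\<in>orbits G X \<phi>. \<forall>a\<in>A. \<forall>b\<in>A. f a = f b"
  proof (intro ballI)
    fix A a b assume "A \<in> orbits G X \<phi>" and ab: "a \<in> A" "b \<in> A"
    then obtain x where "x \<in> X" "A = orbit G \<phi> x" unfolding orbits_def by blast
    then have "f ` A = {f x}" using im by simp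
    then show "f a = f b" using ab by (metis imageI singletonD)
  qed
  ultimately show ?thesis unfolding induces_bij_on_orbits_def by blast
qed

lemma
  assumes "is_category C"
  shows is_category_Id: "x \<in> Ob C \<Longrightarrow> Id C x \<in> Hom C x x"
    and is_category_Comp: "\<lbrakk>x \<in> Ob C; y \<in> Ob C; z \<in> Ob C; f \<in> Hom C x y; g \<in> Hom C y z\<rbrakk>
      \<Longrightarrow> Comp C x y z g f \<in> Hom C x z"
    and is_category_Id_left: "\<lbrakk>x \<in> Ob C; y \<in> Ob C; f \<in> Hom C x y\<rbrakk>
      \<Longrightarrow> Comp C x y y (Id C y) f = f"
    and is_category_Id_right: "\<lbrakk>x \<in> Ob C; y \<in> Ob C; f \<in> Hom C x y\<rbrakk>
      \<Longrightarrow> Comp C x x y f (Id C x) = f"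
    and is_category_assoc: "\<lbrakk>w \<in> Ob C; x \<in> Ob C; y \<in> Ob C; z \<in> Ob C;
        f \<in> Hom C w x; g \<in> Hom C x y; h \<in> Hom C y z\<rbrakk>
      \<Longrightarrow> Comp C w y z h (Comp C w x y g f) = Comp C w x z (Comp C x y z h g) f"
  using assms unfolding is_category_def by blast+

text \<open>Parametrises a class by \<open>Q\<close> itself instead of by Inn(\<open>Q\<close>), so
  that the parameter can later be lifted to a linking system through
  \<open>\<epsilon>\<close>.\<close>

lemma Inn_class_eq_image:
  "Inn_class S P Q \<phi> = (\<lambda>q. compose P (conj_map S Q q) \<phi>) ` Q"
  by (auto simp: Inn_class_def orbit_def Inn_group_def)

section \<open>The orbit category of a fusion system\<close>

locale fusion_sys = group S for S (structure) +
  fixes F :: "'a fusion"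
  assumes fus: "fusion_system S F"
begin

section \<open>Morphisms of a fusion system as group homomorphisms\<close>

lemma
  assumes "subgroup P S" "subgroup Q S" "\<phi> \<in> F P Q"
  shows F_closed: "x \<in> P \<Longrightarrow> \<phi> x \<in> Q"
    and F_mult: "x \<in> P \<Longrightarrow> y \<in> P \<Longrightarrow> \<phi> (x \<otimes> y) = \<phi> x \<otimes> \<phi> y"
    and F_ext: "\<phi> \<in> extensional P"
proof -
  have "\<phi> \<in> Inj_hom S P Q" using fus assms unfolding fusion_system_def by blast
  then show "x \<in> P \<Longrightarrow> \<phi> x \<in> Q" "x \<in> P \<Longrightarrow> y \<in> P \<Longrightarrow> \<phi> (x \<otimes> y) = \<phi> x \<otimes> \<phi> y"
    "\<phi> \<in> extensional P"
    by (auto simp: Inj_hom_def hom_def)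
qed

lemma F_one:
  assumes "subgroup P S" "subgroup Q S" "\<phi> \<in> F P Q"
  shows "\<phi> \<one> = \<one>"
proof -
  have "\<one> \<in> P" using assms by (simp add: subgroup.one_closed)
  moreover from this have "\<phi> \<one> \<in> carrier S"
    by (rule subgroup.mem_carrier[OF assms(2) F_closed[OF assms]])
  ultimately show ?thesis using F_mult[OF assms, of \<one> \<one>] by simp
qed

lemma F_inv:
  assumes "subgroup P S" "subgroup Q S" "\<phi> \<in> F P Q" "x \<in> P"
  shows "\<phi> (inv x) = inv (\<phi> x)"
proof -
  have i: "inv x \<in> P" using assms by (simp add: subgroup.m_inv_closed)
  have "\<phi> (inv x) \<otimes> \<phi> x = \<one>"
    using F_mult[OF assms(1-3) i assms(4)] F_one[OF assms(1-3)] assms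
    by (simp add: subgroup.mem_carrier)
  moreover have "\<phi> x \<in> carrier S" "\<phi> (inv x) \<in> carrier S"
    by (rule subgroup.mem_carrier[OF assms(2) F_closed[OF assms(1-3)]]; fact)+
  ultimately show ?thesis by (simp add: inv_equality)
qed

lemma F_compose:
  assumes "subgroup P S" "subgroup Q S" "subgroup R S" "\<phi> \<in> F P Q" "\<psi> \<in> F Q R"
  shows "compose P \<psi> \<phi> \<in> F P R"
  using is_category_Comp[of "fusion_category S F" P Q R \<phi> \<psi>] fus assms
  by (simp add: fusion_system_def fusion_category_def)

lemma F_id: "subgroup P S \<Longrightarrow> (\<lambda>x\<in>P. x) \<in> F P P"
  using is_category_Id[of "fusion_category S F" P] fus
  by (simp add: fusion_system_def fusion_category_def)

section \<open>Inner automorphisms and their classes\<close>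

lemma mem_transporter:
  assumes "subgroup P S" "g \<in> P"
  shows "g \<in> transporter S P P"
proof -
  interpret P: subgroup P S by fact
  show ?thesis
    using assms(2) by (auto simp: transporter_def l_coset_def r_coset_def)
qed

lemma conj_map_F: "subgroup P S \<Longrightarrow> g \<in> P \<Longrightarrow> conj_map S P g \<in> F P P"
  using fus mem_transporter unfolding fusion_system_def Hom_conj_def by blast

lemma compose_conj_map_mult:
  assumes "subgroup P S" "subgroup Q S" "\<phi> \<in> F P Q" "a \<in> Q" "b \<in> Q"
  shows "compose P (conj_map S Q a) (compose P (conj_map S Q b) \<phi>) =
    compose P (conj_map S Q (a \<otimes> b)) \<phi>"
proof -
  interpret Q: subgroup Q S by fact
  show ?thesis
    using assms F_closed[OF assms(1-3)]
    by (intro ext) (auto simp: compose_def conj_map_def m_assoc inv_mult_group)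
qed

lemma compose_conj_map_one:
  assumes "subgroup P S" "subgroup Q S" "\<phi> \<in> F P Q"
  shows "compose P (conj_map S Q \<one>) \<phi> = \<phi>"
proof -
  interpret Q: subgroup Q S by fact
  show ?thesis
    using F_closed[OF assms] F_ext[OF assms]
    by (intro ext) (auto simp: compose_def conj_map_def extensional_def)
qed

text \<open>Inner automorphisms of the source turn into inner automorphisms of the target; this is
  why postcomposition classes are compatible with composition.\<close>

lemma compose_conj_map_shift:
  assumes "subgroup P S" "subgroup Q S" "\<psi> \<in> F P Q" "g \<in> P"
  shows "compose P \<psi> (conj_map S P g) = compose P (conj_map S Q (\<psi> g)) \<psi>"
proof -
  interpret P: subgroup P S by fact
  show ?thesis
    using assms F_closed[OF assms(1-3)] F_mult[OF assms(1-3)] F_inv[OF assms(1-3)]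
    by (intro ext) (auto simp: compose_def conj_map_def)
qed

lemma Inn_class_self:
  assumes "subgroup P S" "subgroup Q S" "\<phi> \<in> F P Q"
  shows "\<phi> \<in> Inn_class S P Q \<phi>"
  unfolding Inn_class_eq_image
  using compose_conj_map_one[OF assms] subgroup.one_closed[OF assms(2)]
  by (intro image_eqI[where x = \<one>]) auto

text \<open>Right translation by \<open>q\<close> permutes \<open>Q\<close>, so the two classes are
  the same set with different parameters.\<close>

lemma Inn_class_compose_conj_map:
  assumes "subgroup P S" "subgroup Q S" "\<phi> \<in> F P Q" "q \<in> Q"
  shows "Inn_class S P Q (compose P (conj_map S Q q) \<phi>) = Inn_class S P Q \<phi>"
proof -
  interpret Q: subgroup Q S by fact
  have "(\<lambda>a. a \<otimes> q) ` Q = Q"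
  proof
    show "Q \<subseteq> (\<lambda>a. a \<otimes> q) ` Q"
    proof
      fix x assume "x \<in> Q"
      then show "x \<in> (\<lambda>a. a \<otimes> q) ` Q"
        using assms(4) by (intro image_eqI[where x = "x \<otimes> inv q"]) (auto simp: m_assoc)
    qed
  qed (use assms(4) in auto)
  moreover have "Inn_class S P Q (compose P (conj_map S Q q) \<phi>) =
      (\<lambda>a. compose P (conj_map S Q a) \<phi>) ` (\<lambda>a. a \<otimes> q) ` Q"
    unfolding Inn_class_eq_image image_image
    using compose_conj_map_mult[OF assms(1-3) _ assms(4)] by (intro image_cong) auto
  ultimately show ?thesis by (simp add: Inn_class_eq_image)
qed

text \<open>Moving \<open>c_q\<close> to the left of \<open>\<psi>\<close> turns it into conjugation
  by \<open>\<psi> q\<close>, which merges with \<open>c_r\<close>. Hence the elementwise product of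
  two classes is again a single class.\<close>

lemma compose_Inn_class:
  assumes P: "subgroup P S" and Q: "subgroup Q S" and R: "subgroup R S"
    and \<phi>: "\<phi> \<in> F P Q" and \<psi>: "\<psi> \<in> F Q R"
  shows "{compose P b a | b a. b \<in> Inn_class S Q R \<psi> \<and> a \<in> Inn_class S P Q \<phi>} =
    Inn_class S P R (compose P \<psi> \<phi>)" (is "?A = ?B")
proof
  note in_P = subgroup.mem_carrier[OF P] and in_Q = F_closed[OF P Q \<phi>] and in_R = F_closed[OF Q R \<psi>]
  have comp: "compose P \<psi> \<phi> \<in> F P R" using F_compose[OF P Q R \<phi> \<psi>] .
  \<comment> \<open>The inner \<open>compose\<close> is \<open>undefined\<close> outside
    \<open>Q\<close>, hence the condition on the image of \<open>f\<close>.\<close>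
  have assoc: "compose P (compose Q c \<psi>) f = compose P c (compose P \<psi> f)" if "f ` P \<subseteq> Q" for c f
    using that by (intro ext) (auto simp: compose_def)
  show "?A \<subseteq> ?B"
  proof
    fix f assume "f \<in> ?A"
    then obtain r q where r: "r \<in> R" and q: "q \<in> Q"
      and f: "f = compose P (compose Q (conj_map S R r) \<psi>) (compose P (conj_map S Q q) \<phi>)"
      by (auto simp: Inn_class_eq_image)
    have cq: "compose P (conj_map S Q q) \<phi> \<in> F P Q"
      using F_compose[OF P Q Q \<phi> conj_map_F[OF Q q]] .
    have "compose P \<psi> (compose P (conj_map S Q q) \<phi>) =
        compose P (compose Q \<psi> (conj_map S Q q)) \<phi>"
      using in_Q by (intro ext) (auto simp: compose_def)
    also have "\<dots> = compose P (conj_map S R (\<psi> q)) (compose P \<psi> \<phi>)"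
      unfolding compose_conj_map_shift[OF Q R \<psi> q] using in_Q by (intro assoc) auto
    finally have "f = compose P (conj_map S R r) (compose P (conj_map S R (\<psi> q)) (compose P \<psi> \<phi>))"
      using F_closed[OF P Q cq] by (subst f, subst assoc) auto
    also have "\<dots> = compose P (conj_map S R (r \<otimes> \<psi> q)) (compose P \<psi> \<phi>)"
      using compose_conj_map_mult[OF P R comp r in_R[OF q]] .
    finally show "f \<in> ?B"
      using r in_R[OF q] subgroup.m_closed[OF R] by (auto simp: Inn_class_eq_image)
  qed
  show "?B \<subseteq> ?A"
  proof
    fix f assume "f \<in> ?B"
    then obtain r where r: "r \<in> R" and f: "f = compose P (conj_map S R r) (compose P \<psi> \<phi>)"
      by (auto simp: Inn_class_eq_image)
    have "f = compose P (compose Q (conj_map S R r) \<psi>) \<phi>"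
      unfolding f using in_Q by (intro assoc[symmetric]) auto
    moreover have "compose Q (conj_map S R r) \<psi> \<in> Inn_class S Q R \<psi>"
      using r by (auto simp: Inn_class_eq_image)
    \<comment> \<open>The second factor can be \<open>\<phi>\<close> itself, because
      \<open>c_r\<close> is absorbed by the first.\<close>
    ultimately show "f \<in> ?A" using Inn_class_self[OF P Q \<phi>] by blast
  qed
qed

section \<open>The orbit category in terms of representatives\<close>

lemma Ob_orbit_category: "Ob (orbit_category S F) = {P. centric S F P}"
  by (simp add: orbit_category_def)

lemma Hom_orbit_category: "Hom (orbit_category S F) P Q = Inn_class S P Q ` F P Q"
  by (auto simp: orbit_category_def orbits_def Inn_class_def)

lemma Id_orbit_category: "Id (orbit_category S F) P = Inn_class S P P (\<lambda>x\<in>P. x)"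
  by (simp add: orbit_category_def)

lemma Comp_orbit_category:
  assumes "subgroup P S" "subgroup Q S" "subgroup R S" "\<phi> \<in> F P Q" "\<psi> \<in> F Q R"
  shows "Comp (orbit_category S F) P Q R (Inn_class S Q R \<psi>) (Inn_class S P Q \<phi>) =
    Inn_class S P R (compose P \<psi> \<phi>)"
  using compose_Inn_class[OF assms] by (simp add: orbit_category_def)

text \<open>Every morphism is the class of some representative and composition is computed on
  representatives, so each axiom descends from the fusion category.\<close>

lemma is_category_orbit_category: "is_category (orbit_category S F)"
proof -
  have cat: "is_category (fusion_category S F)" using fus by (simp add: fusion_system_def)
  have id_left: "compose P (\<lambda>x\<in>Q. x) \<phi> = \<phi>" and id_right: "compose P \<phi> (\<lambda>x\<in>P. x) = \<phi>"
    if "subgroup P S" "subgroup Q S" "\<phi> \<in> F P Q" for P Q \<phi>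
    using is_category_Id_left[OF cat, of P Q \<phi>] is_category_Id_right[OF cat, of P Q \<phi>] that
    by (simp_all add: fusion_category_def)
  have assoc: "compose P \<chi> (compose P \<psi> \<phi>) = compose P (compose Q \<chi> \<psi>) \<phi>"
    if "subgroup P S" "subgroup Q S" "subgroup R S" "subgroup T S"
      "\<phi> \<in> F P Q" "\<psi> \<in> F Q R" "\<chi> \<in> F R T" for P Q R T \<phi> \<psi> \<chi>
    using is_category_assoc[OF cat, of P Q R T \<phi> \<psi> \<chi>] that by (simp add: fusion_category_def)
  have sub: "subgroup P S" if "centric S F P" for P using that by (simp add: centric_def)
  show ?thesis
    unfolding is_category_def Ob_orbit_category Hom_orbit_category Id_orbit_category mem_Collect_eq
    by (intro conjI ballI; clarsimp dest!: sub
        simp: Comp_orbit_category F_compose F_id id_left id_right assoc)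
qed

end

section \<open>Linking systems\<close>

locale linking_sys = fusion_sys S F for S (structure) and F :: "'a fusion" +
  fixes L :: "('a set, 'm) category"
    and \<epsilon> :: "'a set \<Rightarrow> 'a set \<Rightarrow> 'a \<Rightarrow> 'm"
    and \<pi> :: "'a set \<Rightarrow> 'a set \<Rightarrow> 'm \<Rightarrow> 'a \<Rightarrow> 'a"
  assumes link: "centric_linking_system S F L \<epsilon> \<pi>"
begin

section \<open>The axioms of a linking system\<close>

lemma cat_L: "is_category L"
  using link by (simp add: centric_linking_system_def id_on_objects_functor_def)

lemma Ob_L: "P \<in> Ob L \<longleftrightarrow> centric S F P"
proof -
  have "Ob (transporter_category S F) = Ob L"
    using link by (simp add: centric_linking_system_def id_on_objects_functor_def)
  then show ?thesis by (auto simp: transporter_category_def)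
qed

lemma Ob_subgroup: "P \<in> Ob L \<Longrightarrow> subgroup P S"
  by (simp add: Ob_L centric_def)

lemma
  shows pi_in: "\<lbrakk>P \<in> Ob L; Q \<in> Ob L; f \<in> Hom L P Q\<rbrakk> \<Longrightarrow> \<pi> P Q f \<in> F P Q"
    and pi_Id: "P \<in> Ob L \<Longrightarrow> \<pi> P P (Id L P) = (\<lambda>x\<in>P. x)"
    and pi_Comp: "\<lbrakk>P \<in> Ob L; Q \<in> Ob L; R \<in> Ob L; f \<in> Hom L P Q; g \<in> Hom L Q R\<rbrakk>
      \<Longrightarrow> \<pi> P R (Comp L P Q R g f) = compose P (\<pi> Q R g) (\<pi> P Q f)"
  using link unfolding centric_linking_system_def id_on_objects_functor_def centric_category_def
    full_subcategory_def fusion_category_def by simp_all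

lemma pi_surj: "\<lbrakk>P \<in> Ob L; Q \<in> Ob L\<rbrakk> \<Longrightarrow> \<pi> P Q ` Hom L P Q = F P Q"
  using link by (simp add: centric_linking_system_def)

text \<open>Elements of \<open>P\<close> lie in the transporter from \<open>P\<close> to itself, so
  functoriality and injectivity of \<open>\<epsilon>\<close> restrict to them.\<close>

lemma
  assumes P: "P \<in> Ob L"
  shows eps_in: "g \<in> P \<Longrightarrow> \<epsilon> P P g \<in> Hom L P P"
    and eps_one: "\<epsilon> P P \<one> = Id L P"
    and eps_mult: "\<lbrakk>g \<in> P; h \<in> P\<rbrakk> \<Longrightarrow> \<epsilon> P P (g \<otimes> h) = Comp L P P P (\<epsilon> P P g) (\<epsilon> P P h)"
    and eps_inj: "inj_on (\<epsilon> P P) P"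
    and pi_eps: "g \<in> P \<Longrightarrow> \<pi> P P (\<epsilon> P P g) = conj_map S P g"
proof -
  have c: "centric S F P" using P by (simp add: Ob_L)
  note t = mem_transporter[OF Ob_subgroup[OF P]]
  have fn: "id_on_objects_functor (transporter_category S F) L \<epsilon>"
    using link by (simp add: centric_linking_system_def)
  show "g \<in> P \<Longrightarrow> \<epsilon> P P g \<in> Hom L P P" "\<epsilon> P P \<one> = Id L P"
    "\<lbrakk>g \<in> P; h \<in> P\<rbrakk> \<Longrightarrow> \<epsilon> P P (g \<otimes> h) = Comp L P P P (\<epsilon> P P g) (\<epsilon> P P h)"
    using fn c t by (simp_all add: id_on_objects_functor_def transporter_category_def)
  have "inj_on (\<epsilon> P P) (transporter S P P)"
    using link P by (simp add: centric_linking_system_def)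
  then show "inj_on (\<epsilon> P P) P" by (rule inj_on_subset) (use t in auto)
  show "g \<in> P \<Longrightarrow> \<pi> P P (\<epsilon> P P g) = conj_map S P g"
    using link P t by (simp add: centric_linking_system_def)
qed

section \<open>Composition with elements of the objects\<close>

lemma eps_shift: "\<lbrakk>P \<in> Ob L; Q \<in> Ob L; \<psi> \<in> Hom L P Q; g \<in> P\<rbrakk>
  \<Longrightarrow> Comp L P P Q \<psi> (\<epsilon> P P g) = Comp L P Q Q (\<epsilon> Q Q (\<pi> P Q \<psi> g)) \<psi>"
  using link by (simp add: centric_linking_system_def)

text \<open>Freeness forces \<open>\<epsilon> P P g\<close> to be the identity, which is
  \<open>\<epsilon> P P \<one>\<close>; injectivity of \<open>\<epsilon>\<close> finishes.\<close>

lemma eps_pre_free: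
  assumes P: "P \<in> Ob L" and Q: "Q \<in> Ob L" and \<psi>: "\<psi> \<in> Hom L P Q" and g: "g \<in> P"
    and "Comp L P P Q \<psi> (\<epsilon> P P g) = \<psi>"
  shows "g = \<one>"
proof -
  have "acts_freely ((aut_group L P)\<lparr>carrier := \<epsilon> P P ` P\<rparr>) (Hom L P Q) (\<lambda>a \<psi>. Comp L P P Q \<psi> a)"
    using link P Q by (simp add: centric_linking_system_def)
  then have "\<epsilon> P P g = Id L P"
    using assms by (auto simp: acts_freely_def stabilizer_def aut_group_def)
  then show ?thesis
    using eps_inj[OF P] eps_one[OF P] g subgroup.one_closed[OF Ob_subgroup[OF P]]
    by (metis inj_onD)
qed

text \<open>The orbit bijection modulo the center supplies \<open>z\<close>. Only
  \<open>z \<in> P\<close> is recorded, which is what \<open>eps_shift\<close> asks for.\<close>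

lemma pi_eqD:
  assumes P: "P \<in> Ob L" and Q: "Q \<in> Ob L" and a: "a \<in> Hom L P Q" and b: "b \<in> Hom L P Q"
    and eq: "\<pi> P Q a = \<pi> P Q b"
  obtains z where "z \<in> P" "b = Comp L P P Q a (\<epsilon> P P z)"
proof -
  let ?Z = "center (S\<lparr>carrier := P\<rparr>)"
  let ?G = "(aut_group L P)\<lparr>carrier := \<epsilon> P P ` ?Z\<rparr>"
  let ?act = "\<lambda>a \<psi>. Comp L P P Q \<psi> a"
  interpret P: subgroup P S using Ob_subgroup[OF P] .
  have one: "\<one> \<in> ?Z" by (auto simp: center_def centralizer_def)
  \<comment> \<open>The witness is \<open>\<epsilon> P P \<one>\<close>, the identity
    morphism.\<close>
  have self: "c \<in> orbit ?G ?act c" if "c \<in> Hom L P Q" for c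
    using one that is_category_Id_right[OF cat_L P Q that] eps_one[OF P]
    by (force simp: orbit_def)
  have "induces_bij_on_orbits ?G (Hom L P Q) ?act (\<pi> P Q) (F P Q)"
    using link P Q by (simp add: centric_linking_system_def)
  from induces_bij_on_orbitsD[OF this a b eq self[OF a] self[OF b]]
  obtain z where "z \<in> ?Z" "b = Comp L P P Q a (\<epsilon> P P z)"
    by (auto simp: orbit_def)
  then show thesis using that by (auto simp: center_def centralizer_def)
qed

text \<open>The centralizer condition in \<open>centric\<close> enters here. It is applied not to
  \<open>P\<close> but to its \<open>F\<close>-conjugate, the image of \<open>\<phi>\<close>; the
  element \<open>x\<close> so obtained reduces the claim to freeness of precomposition.\<close>

lemma eps_post_free:
  assumes P: "P \<in> Ob L" and Q: "Q \<in> Ob L" and \<psi>: "\<psi> \<in> Hom L P Q" and q: "q \<in> Q"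
    and fixed: "Comp L P Q Q (\<epsilon> Q Q q) \<psi> = \<psi>"
  shows "q = \<one>"
proof -
  interpret Q: subgroup Q S using Ob_subgroup[OF Q] .
  note sP = Ob_subgroup[OF P] and sQ = Ob_subgroup[OF Q]
  define \<phi> where "\<phi> = \<pi> P Q \<psi>"
  have \<phi>: "\<phi> \<in> F P Q" unfolding \<phi>_def using pi_in[OF P Q \<psi>] .
  have c: "compose P (conj_map S Q q) \<phi> = \<phi>"
    using pi_Comp[OF P Q Q \<psi> eps_in[OF Q q]] pi_eps[OF Q q] fixed by (simp add: \<phi>_def)
  have "q \<otimes> \<phi> x = \<phi> x \<otimes> q" if "x \<in> P" for x
  proof -
    have x: "\<phi> x \<in> Q" using F_closed[OF sP sQ \<phi> that] .
    have "q \<otimes> \<phi> x \<otimes> inv q = \<phi> x"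
      using fun_cong[OF c, of x] that x by (simp add: compose_def conj_map_def)
    moreover have "q \<otimes> \<phi> x = q \<otimes> \<phi> x \<otimes> inv q \<otimes> q" using x q by (simp add: m_assoc)
    ultimately show ?thesis by simp
  qed
  then have cent: "q \<in> centralizer S (\<phi> ` P)" using q by (auto simp: centralizer_def)
  \<comment> \<open>Every morphism of a fusion system is an isomorphism onto its image, so the image
    is conjugate to \<open>P\<close> once it is known to be a subgroup.\<close>
  have iso: "\<phi> \<in> cat_isos (fusion_category S F) P (\<phi> ` P)"
    using fus sP sQ \<phi> by (simp add: fusion_system_def)
  have "group_hom (S\<lparr>carrier := P\<rparr>) S \<phi>"
    using F_closed[OF sP sQ \<phi>] F_mult[OF sP sQ \<phi>] subgroup_imp_group[OF sP]
    by (auto simp: group_hom_def group_hom_axioms_def hom_def)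
  then have "subgroup (\<phi> ` P) S"
    using group_hom.img_is_subgroup[of "S\<lparr>carrier := P\<rparr>" S \<phi>] by simp
  then have "\<phi> ` P \<in> F_conjugates S F P" using iso by (auto simp: F_conjugates_def)
  then have "q \<in> \<phi> ` P" using P cent by (auto simp: Ob_L centric_def)
  then obtain x where x: "x \<in> P" "q = \<phi> x" by blast
  then have "Comp L P P Q \<psi> (\<epsilon> P P x) = \<psi>"
    using eps_shift[OF P Q \<psi>] fixed by (simp add: \<phi>_def)
  then have "x = \<one>" using eps_pre_free[OF P Q \<psi>] x by blast
  then show ?thesis using x F_one[OF sP sQ \<phi>] by simp
qed

text \<open>Serves two purposes: with \<open>a\<close> the identity it computes the kernel, and for
  general \<open>a\<close> it shows that the fibres of the projection are single orbits.\<close>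

lemma Inn_class_pi_eqD:
  assumes P: "P \<in> Ob L" and Q: "Q \<in> Ob L" and a: "a \<in> Hom L P Q" and b: "b \<in> Hom L P Q"
    and eq: "Inn_class S P Q (\<pi> P Q a) = Inn_class S P Q (\<pi> P Q b)"
  obtains q where "q \<in> Q" "b = Comp L P Q Q (\<epsilon> Q Q q) a"
proof -
  note sP = Ob_subgroup[OF P] and sQ = Ob_subgroup[OF Q]
  have "\<pi> P Q b \<in> Inn_class S P Q (\<pi> P Q a)"
    using Inn_class_self[OF sP sQ pi_in[OF P Q b]] eq by simp
  then obtain q where q: "q \<in> Q" and "\<pi> P Q b = compose P (conj_map S Q q) (\<pi> P Q a)"
    by (auto simp: Inn_class_eq_image)
  then have "\<pi> P Q (Comp L P Q Q (\<epsilon> Q Q q) a) = \<pi> P Q b"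
    using pi_Comp[OF P Q Q a eps_in[OF Q q]] pi_eps[OF Q q] by simp
  moreover have "Comp L P Q Q (\<epsilon> Q Q q) a \<in> Hom L P Q"
    using is_category_Comp[OF cat_L P Q Q a eps_in[OF Q q]] .
  ultimately obtain z where z: "z \<in> P"
    and "b = Comp L P P Q (Comp L P Q Q (\<epsilon> Q Q q) a) (\<epsilon> P P z)"
    using pi_eqD[OF P Q _ b] by blast
  then have "b = Comp L P Q Q (\<epsilon> Q Q q) (Comp L P P Q a (\<epsilon> P P z))"
    using is_category_assoc[OF cat_L P P Q Q eps_in[OF P z] a eps_in[OF Q q]] by simp
  \<comment> \<open>Carrying \<open>z\<close> over to the target side lets it combine with
    \<open>q\<close>.\<close>
  also have "\<dots> = Comp L P Q Q (\<epsilon> Q Q q) (Comp L P Q Q (\<epsilon> Q Q (\<pi> P Q a z)) a)"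
    using eps_shift[OF P Q a z] by simp
  also have "\<dots> = Comp L P Q Q (\<epsilon> Q Q (q \<otimes> \<pi> P Q a z)) a"
    using is_category_assoc[OF cat_L P Q Q Q a eps_in[OF Q] eps_in[OF Q q]] eps_mult[OF Q q]
      F_closed[OF sP sQ pi_in[OF P Q a] z] by simp
  finally show thesis
    using that F_closed[OF sP sQ pi_in[OF P Q a] z] q subgroup.m_closed[OF sQ] by blast
qed

lemma orbit_projection_eps:
  assumes P: "P \<in> Ob L" and Q: "Q \<in> Ob L" and a: "a \<in> Hom L P Q" and q: "q \<in> Q"
  shows "orbit_projection S \<pi> P Q (Comp L P Q Q (\<epsilon> Q Q q) a) = orbit_projection S \<pi> P Q a"
  unfolding orbit_projection_def
  using pi_Comp[OF P Q Q a eps_in[OF Q q]] pi_eps[OF Q q]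
    Inn_class_compose_conj_map[OF Ob_subgroup[OF P] Ob_subgroup[OF Q] pi_in[OF P Q a] q]
  by simp

section \<open>The kernel of the projection\<close>

lemma eps_iso:
  assumes P: "P \<in> Ob L" and g: "g \<in> P"
  shows "\<epsilon> P P g \<in> cat_isos L P P"
proof -
  interpret P: subgroup P S using Ob_subgroup[OF P] .
  have "Comp L P P P (\<epsilon> P P (inv g)) (\<epsilon> P P g) = Id L P"
    "Comp L P P P (\<epsilon> P P g) (\<epsilon> P P (inv g)) = Id L P"
    using eps_mult[OF P, symmetric] eps_one[OF P] g by simp_all
  then show ?thesis using eps_in[OF P] g by (auto simp: cat_isos_def)
qed

lemma kernel_orbit_projection:
  assumes P: "P \<in> Ob L"
  shows "kernel (aut_group L P) (aut_group (orbit_category S F) P) (orbit_projection S \<pi> P P) =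
    \<epsilon> P P ` P"
proof -
  have id: "Id L P \<in> Hom L P P" using is_category_Id[OF cat_L P] .
  \<comment> \<open>Lying in the kernel now means having the same projection as
    \<open>Id L P\<close>, so the results on fibres apply to it.\<close>
  have one: "Id (orbit_category S F) P = orbit_projection S \<pi> P P (Id L P)"
    using pi_Id[OF P] by (simp add: Id_orbit_category orbit_projection_def)
  have comp: "Comp L P P P (\<epsilon> P P g) (Id L P) = \<epsilon> P P g" if "g \<in> P" for g
    using is_category_Id_right[OF cat_L P P eps_in[OF P that]] .
  have "f \<in> \<epsilon> P P ` P" if f: "f \<in> cat_isos L P P"
    and eq: "orbit_projection S \<pi> P P f = orbit_projection S \<pi> P P (Id L P)" for f
  proof -
    have "f \<in> Hom L P P" using f by (simp add: cat_isos_def)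
    then obtain g where "g \<in> P" "f = Comp L P P P (\<epsilon> P P g) (Id L P)"
      using Inn_class_pi_eqD[OF P P id _ eq[symmetric, unfolded orbit_projection_def]] by blast
    then show ?thesis using comp by auto
  qed
  moreover have "orbit_projection S \<pi> P P (\<epsilon> P P g) = orbit_projection S \<pi> P P (Id L P)"
    if "g \<in> P" for g
    using orbit_projection_eps[OF P P id that] comp[OF that] by simp
  ultimately show ?thesis
    using eps_iso[OF P] by (auto simp: kernel_def aut_group_def one)
qed

lemma kernel_group_eq:
  assumes P: "P \<in> Ob L"
  shows "kernel_group L (orbit_category S F) (orbit_projection S \<pi>) P =
    (aut_group L P)\<lparr>carrier := \<epsilon> P P ` P\<rparr>"
  by (simp add: kernel_group_def kernel_orbit_projection[OF P])

section \<open>Target regularity\<close>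

lemma id_on_objects_functor_orbit_projection:
  "id_on_objects_functor L (orbit_category S F) (orbit_projection S \<pi>)"
  unfolding id_on_objects_functor_def orbit_projection_def Id_orbit_category Hom_orbit_category
  using cat_L is_category_orbit_category pi_in pi_Id pi_Comp Comp_orbit_category Ob_subgroup
  by (auto simp: Ob_orbit_category Ob_L)

lemma eps_post_acts_freely:
  assumes P: "P \<in> Ob L" and Q: "Q \<in> Ob L"
  shows "acts_freely ((aut_group L Q)\<lparr>carrier := \<epsilon> Q Q ` Q\<rparr>) (Hom L P Q)
    (\<lambda>k f. Comp L P Q Q k f)"
proof -
  have "Id L Q \<in> \<epsilon> Q Q ` Q"
    using eps_one[OF Q] subgroup.one_closed[OF Ob_subgroup[OF Q]] by force
  then show ?thesis
    using eps_post_free[OF P Q] eps_one[OF Q] is_category_Id_left[OF cat_L P Q]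
    by (auto simp: acts_freely_def stabilizer_def aut_group_def)
qed

text \<open>The fibres of the projection are the \<open>Q\<close>-orbits by
  \<open>Inn_class_pi_eqD\<close> and \<open>orbit_projection_eps\<close>; surjectivity is inherited
  from \<open>\<pi>\<close>, as every class has a representative.\<close>

lemma eps_post_bij_on_orbits:
  assumes P: "P \<in> Ob L" and Q: "Q \<in> Ob L"
  shows "induces_bij_on_orbits ((aut_group L Q)\<lparr>carrier := \<epsilon> Q Q ` Q\<rparr>) (Hom L P Q)
    (\<lambda>k f. Comp L P Q Q k f) (orbit_projection S \<pi> P Q) (Hom (orbit_category S F) P Q)"
proof -
  let ?G = "(aut_group L Q)\<lparr>carrier := \<epsilon> Q Q ` Q\<rparr>"
  let ?act = "\<lambda>k f. Comp L P Q Q k f"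
  note sQ = Ob_subgroup[OF Q]
  have orb: "orbit ?G ?act f = (\<lambda>q. Comp L P Q Q (\<epsilon> Q Q q) f) ` Q" for f
    by (auto simp: orbit_def)
  \<comment> \<open>One inclusion suffices, since the hypotheses are symmetric in \<open>x\<close>
    and \<open>y\<close>.\<close>
  have sub: "orbit ?G ?act y \<subseteq> orbit ?G ?act x"
    if x: "x \<in> Hom L P Q" and y: "y \<in> Hom L P Q"
      and eq: "orbit_projection S \<pi> P Q x = orbit_projection S \<pi> P Q y" for x y
  proof -
    obtain q where q: "q \<in> Q" "y = Comp L P Q Q (\<epsilon> Q Q q) x"
      using Inn_class_pi_eqD[OF P Q x y] eq by (auto simp: orbit_projection_def)
    have "Comp L P Q Q (\<epsilon> Q Q r) y = Comp L P Q Q (\<epsilon> Q Q (r \<otimes> q)) x" if "r \<in> Q" for r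
      using is_category_assoc[OF cat_L P Q Q Q x eps_in[OF Q q(1)] eps_in[OF Q that]]
        eps_mult[OF Q that q(1)] q(2) by simp
    then show ?thesis using q(1) subgroup.m_closed[OF sQ] by (auto simp: orb)
  qed
  show ?thesis
  proof (rule induces_bij_on_orbitsI)
    fix g x assume "g \<in> carrier ?G" "x \<in> Hom L P Q"
    then show "orbit_projection S \<pi> P Q (?act g x) = orbit_projection S \<pi> P Q x"
      using orbit_projection_eps[OF P Q] by auto
  next
    fix x assume "x \<in> Hom L P Q"
    then show "x \<in> orbit ?G ?act x"
      using is_category_Id_left[OF cat_L P Q] eps_one[OF Q] subgroup.one_closed[OF sQ]
      by (force simp: orb)
  next
    fix x y assume "x \<in> Hom L P Q" "y \<in> Hom L P Q"
      "orbit_projection S \<pi> P Q x = orbit_projection S \<pi> P Q y"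
    then show "orbit ?G ?act x = orbit ?G ?act y"
      using sub[of x y] sub[of y x] by simp
  next
    show "orbit_projection S \<pi> P Q ` Hom L P Q = Hom (orbit_category S F) P Q"
      unfolding Hom_orbit_category pi_surj[OF P Q, symmetric]
      by (simp add: image_image orbit_projection_def)
  qed
qed

text \<open>The kernel is the image of \<open>P\<close> under \<open>\<epsilon> P P\<close>, so
  surjectivity is built in; the rest is functoriality and injectivity of
  \<open>\<epsilon>\<close>.\<close>

lemma eps_iso_kernel_group:
  assumes P: "P \<in> Ob L"
  shows "restrict (\<epsilon> P P) P \<in>
    iso (S\<lparr>carrier := P\<rparr>) (kernel_group L (orbit_category S F) (orbit_projection S \<pi>) P)"
  using eps_mult[OF P] subgroup.m_closed[OF Ob_subgroup[OF P]] eps_inj[OF P]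
  by (auto simp: kernel_group_eq[OF P] iso_def hom_def bij_betw_def aut_group_def inj_on_def)

lemma target_regular_extension_orbit_projection:
  "target_regular_extension (\<lambda>P. S\<lparr>carrier := P\<rparr>) (\<lambda>P. restrict (\<epsilon> P P) P)
     L (orbit_projection S \<pi>) (orbit_category S F)"
  using id_on_objects_functor_orbit_projection eps_post_acts_freely eps_post_bij_on_orbits
    eps_iso_kernel_group
  by (simp add: target_regular_extension_def target_regular_def kernel_group_eq)

end

theorem lemma10p5:
  fixes p :: nat
    and S :: "('a, 'b) monoid_scheme"
    and F :: "'a fusion"
    and L :: "('a set, 'm) category"
    and \<epsilon> :: "'a set \<Rightarrow> 'a set \<Rightarrow> 'a \<Rightarrow> 'm"
    and \<pi> :: "'a set \<Rightarrow> 'a set \<Rightarrow> 'm \<Rightarrow> 'a \<Rightarrow> 'a"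
  assumes "p_local_finite_group p S F L \<epsilon> \<pi>"
  shows "target_regular_extension (\<lambda>P. S\<lparr>carrier := P\<rparr>) (\<lambda>P. restrict (\<epsilon> P P) P)
           L (orbit_projection S \<pi>) (orbit_category S F)"
proof -
  interpret group S
    using assms
    by (simp add: p_local_finite_group_def saturated_fusion_system_def finite_p_group_def)
  \<comment> \<open>The group axioms are already available, leaving the fusion and linking
    axioms.\<close>
  interpret linking_sys S F L \<epsilon> \<pi>
    by unfold_locales
      (use assms in \<open>simp_all add: p_local_finite_group_def saturated_fusion_system_def\<close>)
  show ?thesis by (rule target_regular_extension_orbit_projection)
qed

end
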